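(* Let $(K,d)$ be a (nonempty) compact metric space and let $q:K\to\mathbb{R}$ be continuous. Put $Q_0:=\arg\max_{\theta\in K}q(\theta)$ and $m:=\max_{\theta\in K}q(\theta)$. Then $Q_0$ is nonempty and compact. Let $q_n:K\to\mathbb{R}$ ($n\ge 1$) be upper semicontinuous and set $Q_n:=\arg\max_{\theta\in K}q_n(\theta)$. Fix $\varepsilon>0$. (1) If $K\setminus B_\varepsilon(Q_0)=\varnothing$, then $Q_n\subseteq B_\varepsilon(Q_0)$ trivially. Otherwise the gap $$\eta(\varepsilon):=m-\max_{\theta\in K\setminus B_\varepsilon(Q_0)}q(\theta)$$ lies in $(0,\infty)$, and if $$\sup_{\theta\in K}|q_n(\theta)-q(\theta)|\le \eta(\varepsilon)/3,$$ then $Q_n\subseteq B_\varepsilon(Q_0)$, and in particular $d_H^+(Q_n,Q_0)\le\varepsilon$. (2) Consequently, if $\sup_{\theta\in K}|q_n(\theta)-q(\theta)|\to 0$ as $n\to\infty$, then $d_H^+(Q_n,Q_0)\to 0$.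
   Context: For $A\subseteq K$ and $\theta\in K$: $d(\theta,A):=\inf_{a\in A}d(\theta,a)$ and $B_\varepsilon(A):=\{\theta\in K: d(\theta,A)<\varepsilon\}$. For nonempty compact sets $A,B\subset K$, the directed Hausdorff distance is $d_H^+(A,B):=\sup_{a\in A}d(a,B)$. *)

theory Defs
  imports "HOL-Analysis.Analysis"
begin

definition argmax_set :: "('a \<Rightarrow> real) \<Rightarrow> 'a set \<Rightarrow> 'a set" where
  "argmax_set f S = {x. is_arg_max f (\<lambda>y. y \<in> S) x}"

text \<open>A genuine maximum rather than a supremum: unspecified if \<open>f\<close> does not attain a
  largest value on \<open>S\<close>, i.e. if \<open>argmax_set f S\<close> is empty.\<close>

definition max_value :: "('a \<Rightarrow> real) \<Rightarrow> 'a set \<Rightarrow> real" where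
  "max_value f S = (GREATEST v. v \<in> f ` S)"

text \<open>Upper semicontinuity on \<open>S\<close>, with respect to the subspace topology of \<open>S\<close>.\<close>

definition usc_on :: "'a::topological_space set \<Rightarrow> ('a \<Rightarrow> real) \<Rightarrow> bool" where
  "usc_on S f \<longleftrightarrow> (\<forall>x\<in>S. \<forall>c. f x < c \<longrightarrow> (\<forall>\<^sub>F y in at x within S. f y < c))"

text \<open>The following two notions are meant for nonempty \<open>A\<close> and \<open>B\<close>: by convention
  \<open>infdist x {} = 0\<close>, and the supremum of the empty set of reals is unspecified.\<close>

definition nbhd_in :: "'a::metric_space set \<Rightarrow> real \<Rightarrow> 'a set \<Rightarrow> 'a set" where
  "nbhd_in K \<epsilon> A = {x \<in> K. infdist x A < \<epsilon>}"

definition dir_hausdorff :: "'a::metric_space set \<Rightarrow> 'a set \<Rightarrow> real" where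
  "dir_hausdorff A B = (SUP a\<in>A. infdist a B)"

definition gap :: "'a::metric_space set \<Rightarrow> ('a \<Rightarrow> real) \<Rightarrow> real \<Rightarrow> real" where
  "gap K q \<epsilon> = max_value q K - max_value q (K - nbhd_in K \<epsilon> (argmax_set q K))"

text \<open>The supremum is taken in the extended reals, since \<open>f - g\<close> may be unbounded on \<open>K\<close>:
  an upper semicontinuous function on a compact set need not be bounded below.\<close>

definition sup_dev :: "'a set \<Rightarrow> ('a \<Rightarrow> real) \<Rightarrow> ('a \<Rightarrow> real) \<Rightarrow> ereal" where
  "sup_dev K f g = (SUP x\<in>K. ereal \<bar>f x - g x\<bar>)"

end

theory Submission
  imports Defs
begin

text \<open>A maximizer of the perturbed function outside the neighbourhood would have \<open>q\<close>-value at most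
  \<open>m - \<eta>\<close>, hence perturbed value at most \<open>m - 2\<eta>/3\<close>, whereas a maximizer of \<open>q\<close> has perturbed
  value at least \<open>m - \<eta>/3\<close>.\<close>

lemma argmax_set_iff: "x \<in> argmax_set f S \<longleftrightarrow> x \<in> S \<and> (\<forall>y\<in>S. f y \<le> f x)"
  by (auto simp: argmax_set_def is_arg_max_def not_less)

lemma max_value_eq: "x \<in> argmax_set f S \<Longrightarrow> max_value f S = f x"
  unfolding max_value_def by (rule Greatest_equality) (auto simp: argmax_set_iff)

lemma usc_on_continuous: "continuous_on S f \<Longrightarrow> usc_on S f"
  unfolding usc_on_def continuous_on_def by (auto intro: order_tendstoD)

text \<open>The strict sublevel set is relatively open: upper semicontinuity gives a punctured
  neighbourhood of \<open>x\<close> on which \<open>f\<close> stays below \<open>c\<close>, and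
  \<open>x\<close> itself satisfies the bound by choice. Its complement in \<open>S\<close> is
  relatively closed, hence closed because \<open>S\<close> is.\<close>

lemma usc_on_superlevel_closed:
  assumes "usc_on S f" "closed S"
  shows "closed {x \<in> S. c \<le> f x}"
proof -
  have "openin (top_of_set S) {x \<in> S. f x < c}"
  proof (subst openin_subopen, clarify)
    fix x assume x: "x \<in> S" "f x < c"
    then obtain T where T: "open T" "x \<in> T" "\<And>y. y \<in> T \<Longrightarrow> y \<noteq> x \<Longrightarrow> y \<in> S \<Longrightarrow> f y < c"
      using assms(1) unfolding usc_on_def eventually_at_topological by meson
    have "openin (top_of_set S) (S \<inter> T)"
      using T(1) by blast
    moreover have "S \<inter> T \<subseteq> {x \<in> S. f x < c}"
      using T(3) x by blast
    ultimately show "\<exists>T. openin (top_of_set S) T \<and> x \<in> T \<and> T \<subseteq> {x \<in> S. f x < c}"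
      using T(2) x(1) by blast
  qed
  then have "closedin (top_of_set S) (S - {x \<in> S. f x < c})"
    by (auto simp: closedin_diff)
  moreover have "S - {x \<in> S. f x < c} = {x \<in> S. c \<le> f x}"
    by auto
  ultimately show ?thesis
    using assms(2) closedin_closed_trans by metis
qed

text \<open>The maximizers are exactly the points lying in all superlevel sets \<open>L z\<close>
  with \<open>z\<close> in \<open>S\<close>. These sets are closed, so by compactness it suffices
  that finitely many of them meet.\<close>

lemma usc_on_argmax_nonempty:
  fixes S :: "'a::t2_space set"
  assumes "usc_on S f" "compact S" "S \<noteq> {}"
  shows "argmax_set f S \<noteq> {}"
proof -
  define L where "L z = {x \<in> S. f z \<le> f x}" for z
  have "S \<inter> \<Inter>(L ` S) \<noteq> {}"
  proof (rule compact_imp_fip[OF assms(2)])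
    show "closed T" if "T \<in> L ` S" for T
      using that assms by (auto simp: L_def intro: usc_on_superlevel_closed compact_imp_closed)
    fix F assume "finite F" "F \<subseteq> L ` S"
    then obtain Z where Z: "Z \<subseteq> S" "finite Z" "F = L ` Z"
      by (meson finite_subset_image)
    show "S \<inter> \<Inter>F \<noteq> {}"
    proof (cases "Z = {}")
      case False
      \<comment> \<open>The best point among the finitely many elements of \<open>Z\<close> lies in
        every \<open>L z\<close> with \<open>z\<close> in \<open>Z\<close>.\<close>
      then have "Max (f ` Z) \<in> f ` Z"
        using Z(2) by (intro Max_in) auto
      then obtain z where "z \<in> Z" "f z = Max (f ` Z)"
        by (metis imageE)
      then have "z \<in> Z" "\<And>y. y \<in> Z \<Longrightarrow> f y \<le> f z"
        using Z(2) by auto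
      then have "z \<in> S \<inter> \<Inter>F"
        using Z by (auto simp: L_def)
      then show ?thesis by blast
    \<comment> \<open>For empty \<open>Z\<close> the intersection is the whole type, so
      \<open>S \<noteq> {}\<close> is what remains.\<close>
    qed (use Z assms in auto)
  qed
  then show ?thesis
    by (auto simp: L_def argmax_set_iff ex_in_conv[symmetric])
qed

text \<open>Once a maximizer \<open>z\<close> exists, the set of maximizers is the superlevel set at
  height \<open>f z\<close>, a closed subset of \<open>S\<close>.\<close>

lemma usc_on_argmax_compact:
  fixes S :: "'a::t2_space set"
  assumes "usc_on S f" "compact S"
  shows "compact (argmax_set f S)"
proof (cases "argmax_set f S = {}")
  case False
  then obtain z where "z \<in> argmax_set f S" by blast
  then have "argmax_set f S = S \<inter> {x \<in> S. f z \<le> f x}"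
    by (auto simp: argmax_set_iff) (metis order_trans)
  then show ?thesis
    using assms by (simp add: compact_Int_closed usc_on_superlevel_closed compact_imp_closed)
qed simp

lemma compact_diff_nbhd_in:
  assumes "compact K"
  shows "compact (K - nbhd_in K \<epsilon> A)"
proof -
  have "K - nbhd_in K \<epsilon> A = K \<inter> {x. \<epsilon> \<le> infdist x A}"
    by (auto simp: nbhd_in_def)
  moreover have "closed {x. \<epsilon> \<le> infdist x A}"
    by (intro closed_Collect_le continuous_intros)
  ultimately show ?thesis
    using assms by (simp add: compact_Int_closed)
qed

text \<open>A supremum of reals can be estimated only over a nonempty set bounded above; the
  inclusion supplies the bound \<epsilon>. The lower bound 0 later turns smallness into convergence
  to 0.\<close>

lemma dir_hausdorff_nonneg_le:
  assumes "A \<noteq> {}" "A \<subseteq> nbhd_in K \<epsilon> B"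
  shows "0 \<le> dir_hausdorff A B" "dir_hausdorff A B \<le> \<epsilon>"
proof -
  have le: "infdist a B \<le> \<epsilon>" if "a \<in> A" for a
    using that assms(2) by (force simp: nbhd_in_def)
  then show "dir_hausdorff A B \<le> \<epsilon>"
    unfolding dir_hausdorff_def using assms(1) by (intro cSUP_least)
  obtain a where "a \<in> A"
    using assms(1) by blast
  moreover have "bdd_above ((\<lambda>a. infdist a B) ` A)"
    using le by (intro bdd_aboveI2)
  ultimately show "0 \<le> dir_hausdorff A B"
    unfolding dir_hausdorff_def by (intro cSUP_upper2) (auto simp: infdist_nonneg)
qed

text \<open>By compactness \<open>q\<close> attains its maximum over the complement at some
  \<open>y\<close>, so \<open>gap\<close> is a difference of two attained values. It is positive
  because \<open>y\<close> cannot be a maximizer over \<open>K\<close>.\<close>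

lemma gap_pos:
  assumes "compact K" "continuous_on K q" "0 < \<epsilon>" "K - nbhd_in K \<epsilon> (argmax_set q K) \<noteq> {}"
  shows "argmax_set q (K - nbhd_in K \<epsilon> (argmax_set q K)) \<noteq> {}" "0 < gap K q \<epsilon>"
proof -
  let ?C = "K - nbhd_in K \<epsilon> (argmax_set q K)"
  show ne: "argmax_set q ?C \<noteq> {}"
    using assms by (intro usc_on_argmax_nonempty usc_on_continuous compact_diff_nbhd_in)
      (auto intro: continuous_on_subset)
  then obtain y where y: "y \<in> argmax_set q ?C" by blast
  obtain x where x: "x \<in> argmax_set q K"
    using usc_on_argmax_nonempty[OF usc_on_continuous] assms by blast
  have yK: "y \<in> K" "\<epsilon> \<le> infdist y (argmax_set q K)"
    using y by (auto simp: argmax_set_iff[of y] nbhd_in_def)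
  \<comment> \<open>Points of a set have \<open>infdist\<close> 0 to it, which is less than
    \<epsilon>.\<close>
  then have "y \<notin> argmax_set q K"
    using assms(3) by auto
  then have "q y < q x"
    using x yK(1) unfolding argmax_set_iff by force
  then show "0 < gap K q \<epsilon>"
    using max_value_eq[OF x] max_value_eq[OF y] by (simp add: gap_def)
qed

lemma argmax_set_subset_nbhd_in:
  assumes "compact K" "continuous_on K q" "0 < \<epsilon>"
    and "K - nbhd_in K \<epsilon> (argmax_set q K) \<noteq> {}"
    and dev: "sup_dev K f q \<le> ereal (gap K q \<epsilon> / 3)"
  shows "argmax_set f K \<subseteq> nbhd_in K \<epsilon> (argmax_set q K)"
proof
  let ?C = "K - nbhd_in K \<epsilon> (argmax_set q K)"
  fix z assume z: "z \<in> argmax_set f K"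
  have close: "\<bar>f x - q x\<bar> \<le> gap K q \<epsilon> / 3" if "x \<in> K" for x
    using dev that unfolding sup_dev_def SUP_le_iff by auto
  note pos = gap_pos[OF assms(1-4)]
  obtain y where y: "y \<in> argmax_set q ?C" using pos(1) by blast
  obtain x where x: "x \<in> argmax_set q K"
    using usc_on_argmax_nonempty[OF usc_on_continuous] assms by blast
  have gap: "gap K q \<epsilon> = q x - q y"
    using max_value_eq[OF x] max_value_eq[OF y] by (simp add: gap_def)
  have K: "x \<in> K" "z \<in> K" "f x \<le> f z"
    using x z by (auto simp: argmax_set_iff)
  show "z \<in> nbhd_in K \<epsilon> (argmax_set q K)"
  proof (rule ccontr)
    assume "z \<notin> nbhd_in K \<epsilon> (argmax_set q K)"
    then have "q z \<le> q y"
      using y K by (auto simp: argmax_set_iff[of y])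
    \<comment> \<open>Two deviations cost at most two thirds of the gap \<open>q x - q y\<close>; as
      the gap is positive, this forces \<open>f z < f x\<close>.\<close>
    then show False
      using close[OF K(1)] close[OF K(2)] K(3) gap pos(2) by linarith
  qed
qed

theorem lemma2p1:
  fixes K :: "'a::metric_space set"
    and q :: "'a \<Rightarrow> real"
    and qn :: "nat \<Rightarrow> 'a \<Rightarrow> real"
  assumes "compact K" and "K \<noteq> {}"
    and "continuous_on K q"
    and "\<And>n. n \<ge> 1 \<Longrightarrow> usc_on K (qn n)"
  shows "argmax_set q K \<noteq> {} \<and> compact (argmax_set q K) \<and>
    (\<forall>n\<ge>1. argmax_set (qn n) K \<noteq> {} \<and> compact (argmax_set (qn n) K)) \<and>
    (\<forall>\<epsilon>>0.
      (K - nbhd_in K \<epsilon> (argmax_set q K) = {} \<longrightarrow>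
        (\<forall>n\<ge>1. argmax_set (qn n) K \<subseteq> nbhd_in K \<epsilon> (argmax_set q K))) \<and>
      (K - nbhd_in K \<epsilon> (argmax_set q K) \<noteq> {} \<longrightarrow>
        argmax_set q (K - nbhd_in K \<epsilon> (argmax_set q K)) \<noteq> {} \<and>
        0 < gap K q \<epsilon> \<and>
        (\<forall>n\<ge>1. sup_dev K (qn n) q \<le> ereal (gap K q \<epsilon> / 3) \<longrightarrow>
          argmax_set (qn n) K \<subseteq> nbhd_in K \<epsilon> (argmax_set q K) \<and>
          dir_hausdorff (argmax_set (qn n) K) (argmax_set q K) \<le> \<epsilon>))) \<and>
    ((\<lambda>n. sup_dev K (qn n) q) \<longlonglongrightarrow> 0 \<longrightarrow>
      (\<lambda>n. dir_hausdorff (argmax_set (qn n) K) (argmax_set q K)) \<longlonglongrightarrow> 0)"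
proof (intro conjI allI impI)
  let ?Q = "argmax_set q K"
  have usc: "usc_on K q"
    using assms(3) by (rule usc_on_continuous)
  show "?Q \<noteq> {}" "compact ?Q"
    using usc assms by (auto intro: usc_on_argmax_compact dest: usc_on_argmax_nonempty)
  show ne: "argmax_set (qn n) K \<noteq> {}" if "1 \<le> n" for n
    using assms that by (intro usc_on_argmax_nonempty) auto
  show "compact (argmax_set (qn n) K)" if "1 \<le> n" for n
    using assms that by (intro usc_on_argmax_compact) auto
  show trivial: "argmax_set (qn n) K \<subseteq> nbhd_in K \<epsilon> ?Q" if "K - nbhd_in K \<epsilon> ?Q = {}" for \<epsilon> n
    using that by (auto simp: argmax_set_iff[of _ "qn n"])
  show "argmax_set q (K - nbhd_in K \<epsilon> ?Q) \<noteq> {}" "0 < gap K q \<epsilon>"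
    if "0 < \<epsilon>" "K - nbhd_in K \<epsilon> ?Q \<noteq> {}" for \<epsilon>
    using gap_pos assms(1,3) that by blast+
  show sub: "argmax_set (qn n) K \<subseteq> nbhd_in K \<epsilon> ?Q"
    if "0 < \<epsilon>" "K - nbhd_in K \<epsilon> ?Q \<noteq> {}" "sup_dev K (qn n) q \<le> ereal (gap K q \<epsilon> / 3)" for \<epsilon> n
    using argmax_set_subset_nbhd_in assms(1,3) that by blast
  show "dir_hausdorff (argmax_set (qn n) K) ?Q \<le> \<epsilon>"
    if "0 < \<epsilon>" "K - nbhd_in K \<epsilon> ?Q \<noteq> {}" "1 \<le> n" "sup_dev K (qn n) q \<le> ereal (gap K q \<epsilon> / 3)"
    for \<epsilon> n
    using dir_hausdorff_nonneg_le(2)[OF ne sub] that by blast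
  assume lim: "(\<lambda>n. sup_dev K (qn n) q) \<longlonglongrightarrow> 0"
  show "(\<lambda>n. dir_hausdorff (argmax_set (qn n) K) ?Q) \<longlonglongrightarrow> 0"
  proof (rule tendstoI)
    fix e :: real assume e: "0 < e"
    \<comment> \<open>The inclusion yields only a non-strict bound on the supremum, so radius
      \<open>e / 2\<close> is used to end strictly below \<open>e\<close>.\<close>
    have "\<forall>\<^sub>F n in sequentially. argmax_set (qn n) K \<subseteq> nbhd_in K (e / 2) ?Q"
    proof (cases "K - nbhd_in K (e / 2) ?Q = {}")
      case True
      then show ?thesis using trivial by simp
    next
      case False
      then have "0 < ereal (gap K q (e / 2) / 3)"
        using gap_pos(2)[of K q "e / 2"] assms(1,3) e by simp
      then have "\<forall>\<^sub>F n in sequentially. sup_dev K (qn n) q < ereal (gap K q (e / 2) / 3)"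
        using lim by (intro order_tendstoD)
      then show ?thesis
        by eventually_elim (use sub False e in auto)
    qed
    then show "\<forall>\<^sub>F n in sequentially. dist (dir_hausdorff (argmax_set (qn n) K) ?Q) 0 < e"
      \<comment> \<open>Nothing is assumed about \<open>qn 0\<close>, so its set of maximizers may
        be empty; restricting to indices from 1 on makes \<open>ne\<close> available.\<close>
      using eventually_ge_at_top[of 1]
    proof eventually_elim
      case (elim n)
      then show ?case
        using dir_hausdorff_nonneg_le[OF ne elim(1)] e by (simp add: dist_real_def)
    qed
  qed
qed

end
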